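(* Let $L : \mathcal{S}^n \to \mathcal{S}^n$ be a linear map. Then $L$ is an onto preserver of Schur stability (that is, $L$ maps the set of Schur stable matrices in $\mathcal{S}^n$ onto itself) if and only if there exist an orthogonal matrix $R \in M_n(\mathbb{R})$ and $c \in \{1,-1\}$ such that $L(A) = c\, R A R^t$ for all $A \in \mathcal{S}^n$.
   Context: $M_n(\mathbb{R})$ is the space of $n \times n$ real matrices and $\mathcal{S}^n$ is its subspace of real symmetric matrices. A matrix is Schur stable if all its eigenvalues lie in the open unit disc. $R^t$ denotes the transpose of $R$. *)

theory Defs
  imports "HOL-Analysis.Analysis"
begin

definition sym_mats :: "(real^'n^'n) set" where
  "sym_mats = {A. transpose A = A}"

text \<open>A linear map from the symmetric matrices to themselves is represented by a function on all
  matrices; its values outside \<^term>\<open>sym_mats\<close> are irrelevant and unconstrained.\<close>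

definition linear_on_sym_mats :: "(real^'n^'n \<Rightarrow> real^'n^'n) \<Rightarrow> bool" where
  "linear_on_sym_mats L \<longleftrightarrow>
     (\<forall>A\<in>sym_mats. L A \<in> sym_mats) \<and>
     (\<forall>A\<in>sym_mats. \<forall>B\<in>sym_mats. L (A + B) = L A + L B) \<and>
     (\<forall>r. \<forall>A\<in>sym_mats. L (r *\<^sub>R A) = r *\<^sub>R L A)"

definition eigenvalue :: "'a::field^'n^'n \<Rightarrow> 'a \<Rightarrow> bool" where
  "eigenvalue A z \<longleftrightarrow> (\<exists>v. v \<noteq> 0 \<and> A *v v = z *s v)"

text \<open>The eigenvalues of a real matrix are taken over the complex numbers.\<close>

definition schur_stable :: "real^'n^'n \<Rightarrow> bool" where
  "schur_stable A \<longleftrightarrow> (\<forall>z. eigenvalue (map_matrix complex_of_real A) z \<longrightarrow> cmod z < 1)"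

definition onto_preserver_schur_stability :: "(real^'n^'n \<Rightarrow> real^'n^'n) \<Rightarrow> bool" where
  "onto_preserver_schur_stability L \<longleftrightarrow>
     L ` {A \<in> sym_mats. schur_stable A} = {A \<in> sym_mats. schur_stable A}"

end

theory Submission
  imports Defs
begin

text \<open>A symmetric matrix is Schur stable iff its quadratic form is less than $|x|^2$ in absolute value
  off $0$, so an onto preserver \<open>L\<close> is a bijective isometry for the norm $\|A\| = \max_{|x|=1} |x^t A x|$.

  Since $\max(\|I + A\|, \|I - A\|) = 1 + \|A\|$ for all \<open>A\<close>, the same holds for \<open>U = L I\<close> in place
  of \<open>I\<close>; testing this on rank-one projections $x x^t$ gives $|x^t U x| = |x|^2$ for all \<open>x\<close>, hence
  \<open>U = I\<close> or \<open>U = - I\<close>. Up to sign, \<open>L\<close> fixes \<open>I\<close> and is thus an isomorphism for the positive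
  semidefinite order. The inequalities $E_{ii} \le I$ and $E_{ii} + E_{jj} \le I$ force
  $L(E_{ii}) = f_i f_i^t$ for an orthonormal basis \<open>f\<close>, which may be taken to be the standard one.
  Positivity of the images of $(a e_i + b e_j)(a e_i + b e_j)^t$ then shows
  $L(E_{ij} + E_{ji}) = t_{ij} (E_{ij} + E_{ji})$ with $t_{ij} = 1$ or $t_{ij} = -1$, and positivity of the
  image of $(e_i + e_j + e_k)(e_i + e_j + e_k)^t$ gives $t_{ij} = t_{ki} t_{kj}$. So \<open>L\<close> is
  conjugation by a diagonal sign matrix.\<close>

section \<open>Quadratic forms and symmetrised outer products\<close>

definition qform :: "real^'n^'n \<Rightarrow> real^'n \<Rightarrow> real" where
  "qform A x = x \<bullet> (A *v x)"

definition psd :: "real^'n^'n \<Rightarrow> bool" where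
  "psd A \<longleftrightarrow> (\<forall>x. 0 \<le> qform A x)"

text \<open>The norm of the quadratic form, encoded by its closed balls: for symmetric
  \<open>A\<close> this says that the spectral norm is at most \<open>r\<close>.\<close>

definition qbound :: "real^'n^'n \<Rightarrow> real \<Rightarrow> bool" where
  "qbound A r \<longleftrightarrow> (\<forall>x. \<bar>qform A x\<bar> \<le> r * (x \<bullet> x))"

text \<open>The symmetrised outer product (x y^t + y x^t) / 2; \<open>symprod x x\<close> is the
  rank-one matrix x x^t, and mixed products come from it by polarisation.\<close>

definition symprod :: "real^'n \<Rightarrow> real^'n \<Rightarrow> real^'n^'n" where
  "symprod x y = (\<chi> k l. (x $ k * y $ l + y $ k * x $ l) / 2)"

lemma sym_inner: "A \<in> sym_mats \<Longrightarrow> x \<bullet> (A *v y) = (A *v x) \<bullet> (y::real^'n)"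
  by (metis (mono_tags, lifting) dot_lmul_matrix mem_Collect_eq sym_mats_def transpose_matrix_vector)

lemma subspace_sym_mats: "subspace (sym_mats :: (real^'n^'n) set)"
  by (auto simp: subspace_def sym_mats_def transpose_def vec_eq_iff)

lemma mat_sym_mats [simp]: "mat a \<in> sym_mats"
  by (simp add: sym_mats_def)

lemma symprod_sym_mats [simp]: "symprod x y \<in> sym_mats"
  by (simp add: sym_mats_def symprod_def transpose_def vec_eq_iff)

lemma qform_add: "qform (A + B) x = qform A x + qform B x"
  by (simp add: qform_def matrix_vector_mult_add_rdistrib inner_add_right)

lemma qform_diff: "qform (A - B) x = qform A x - qform B x"
  by (simp add: qform_def matrix_vector_mult_diff_rdistrib inner_diff_right)

lemma qform_scaleR: "qform (c *\<^sub>R A) x = c * qform A x"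
  by (simp add: qform_def scaleR_matrix_vector_assoc[symmetric])

lemma qform_minus: "qform (- A) x = - qform A x"
  using qform_scaleR[of "-1" A x] by simp

lemma qform_mat1 [simp]: "qform (mat 1) x = x \<bullet> x"
  by (simp add: qform_def)

lemma qform_arg_scaleR: "qform A (c *\<^sub>R x) = c\<^sup>2 * qform A x"
  by (simp add: qform_def matrix_vector_mult_scaleR power2_eq_square)

lemma qform_arg_add:
  "A \<in> sym_mats \<Longrightarrow> qform A (x + y) = qform A x + 2 * (y \<bullet> (A *v x)) + qform A y"
  by (simp add: qform_def matrix_vector_right_distrib inner_add sym_inner[of A x y] inner_commute)

lemma qform_axis: "qform A (axis i 1) = A $ i $ i"
  by (simp add: qform_def inner_axis' matrix_vector_mul_component inner_axis)

lemma qform_congruence: "qform (transpose R ** A ** R) x = qform A (R *v x)"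
  by (metis (no_types, lifting) qform_def dot_lmul_matrix inner_commute matrix_vector_mul_assoc
      transpose_matrix_vector)

lemma congruence_sym_mats: "A \<in> sym_mats \<Longrightarrow> transpose R ** A ** R \<in> sym_mats"
  by (simp add: sym_mats_def matrix_transpose_mul matrix_mul_assoc)

lemma symprod_mult: "symprod x y *v z = ((y \<bullet> z) / 2) *\<^sub>R x + ((x \<bullet> z) / 2) *\<^sub>R y"
  by (simp add: vec_eq_iff symprod_def matrix_vector_mult_def inner_vec_def algebra_simps
      sum.distrib sum_distrib_left sum_divide_distrib add_divide_distrib)

lemma qform_symprod: "qform (symprod x y) z = (x \<bullet> z) * (y \<bullet> z)"
  by (simp add: qform_def symprod_mult inner_add inner_commute)

lemma psd_symprod_self: "psd (symprod x x)"
  by (simp add: psd_def qform_symprod)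

lemma continuous_qform: "continuous_on S (qform A)"
  unfolding qform_def by (intro continuous_intros linear_continuous_on matrix_vector_mul_bounded_linear)

section \<open>Null vectors and extreme values of quadratic forms\<close>

text \<open>Moving from \<open>x\<close> in direction \<open>A *v x\<close> changes the form by
  \<open>2 * t * s + t\<^sup>2 * q\<close>, where \<open>s\<close> is the squared length of
  \<open>A *v x\<close>. For small negative \<open>t\<close> the linear term wins unless
  \<open>s = 0\<close>.\<close>

lemma psd_null_vector:
  fixes A :: "real^'n^'n"
  assumes A: "A \<in> sym_mats" "psd A" and x: "qform A x = 0"
  shows "A *v x = 0"
proof -
  let ?y = "A *v x"
  define q where "q = qform A ?y"
  define s where "s = ?y \<bullet> ?y"
  have q: "q \<ge> 0" using A by (simp add: psd_def q_def)
  have le: "0 \<le> 2 * t * s + t\<^sup>2 * q" for t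
  proof -
    have "0 \<le> qform A (x + t *\<^sub>R ?y)" using A by (simp add: psd_def)
    also have "\<dots> = 2 * t * s + t\<^sup>2 * q"
      using A x by (simp add: qform_arg_add qform_arg_scaleR q_def s_def)
    finally show ?thesis .
  qed
  have "s \<ge> 0" by (simp add: s_def)
  \<comment> \<open>The minimiser would be \<open>- s / q\<close>; the added 1 also covers
    \<open>q = 0\<close>.\<close>
  define t where "t = - s / (1 + q)"
  have t: "t * (1 + q) = - s" using q by (simp add: t_def)
  have "0 \<le> (1 + q)\<^sup>2 * (2 * t * s + t\<^sup>2 * q)" using le by simp
  also have "\<dots> = 2 * (1 + q) * (t * (1 + q)) * s + (t * (1 + q))\<^sup>2 * q"
    by (simp add: power2_eq_square algebra_simps)
  also have "\<dots> = - (s\<^sup>2 * (2 + q))"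
    unfolding t by (simp add: power2_eq_square algebra_simps)
  finally have "s\<^sup>2 * (2 + q) \<le> 0" by simp
  then have "s = 0" using q by (simp add: mult_le_0_iff)
  then show ?thesis by (simp add: s_def)
qed

text \<open>Compactness of the unit sphere gives the maximum, homogeneity of degree 2 carries it to
  all vectors.\<close>

lemma qform_attains_max:
  fixes A :: "real^'n^'n"
  obtains z where "z \<bullet> z = 1" "\<And>x. qform A x \<le> qform A z * (x \<bullet> x)"
proof -
  have ne: "sphere (0::real^'n) 1 \<noteq> {}" by simp
  obtain z where z: "z \<in> sphere 0 1" "\<And>x. x \<in> sphere 0 1 \<Longrightarrow> qform A x \<le> qform A z"
    using continuous_attains_sup[OF compact_sphere ne continuous_qform[of _ A]] by blast
  have "qform A x \<le> qform A z * (x \<bullet> x)" for x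
  proof (cases "x = 0")
    case True then show ?thesis by (simp add: qform_def)
  next
    case False
    then have "(1 / norm x) *\<^sub>R x \<in> sphere 0 1" by simp
    from z(2)[OF this] have "qform A x / (norm x)\<^sup>2 \<le> qform A z"
      by (simp add: qform_arg_scaleR power_divide)
    then show ?thesis using False by (simp add: field_simps power2_norm_eq_inner)
  qed
  moreover have "z \<bullet> z = 1" using z(1) by (simp add: norm_eq_1)
  ultimately show ?thesis using that by blast
qed

text \<open>The largest absolute value is a maximum of the form of \<open>A\<close> or of
  \<open>- A\<close>. The sign \<open>e\<close> records which, so that the norm is an expression
  linear in \<open>A\<close> once \<open>z\<close> and \<open>e\<close> are fixed.\<close>

lemma abs_qform_attains_max:
  fixes A :: "real^'n^'n"
  obtains z e where "z \<bullet> z = 1" "e \<in> {1, -1::real}" "0 \<le> e * qform A z" "qbound A (e * qform A z)"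
proof -
  obtain y where y: "y \<bullet> y = 1" "\<And>x. qform A x \<le> qform A y * (x \<bullet> x)"
    using qform_attains_max[of A] by blast
  obtain z where z: "z \<bullet> z = 1" "\<And>x. qform (-A) x \<le> qform (-A) z * (x \<bullet> x)"
    using qform_attains_max[of "-A"] by blast
  have zy: "- qform A y \<le> - qform A z" "qform A z \<le> qform A y"
    using z(2)[of y] y(2)[of z] z(1) y(1) by (auto simp: qform_minus)
  show ?thesis
  \<comment> \<open>Here \<open>qform A y\<close> is the largest value on the unit sphere and
    \<open>qform A z\<close> the smallest.\<close>
  proof (cases "- qform A z \<le> qform A y")
    case True
    have "qbound A (qform A y)"
      unfolding qbound_def
    proof
      fix x :: "real^'n"
      have "- qform A z * (x \<bullet> x) \<le> qform A y * (x \<bullet> x)" using True by (intro mult_right_mono) auto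
      then show "\<bar>qform A x\<bar> \<le> qform A y * (x \<bullet> x)" using y(2)[of x] z(2)[of x]
        by (auto simp: qform_minus)
    qed
    then show ?thesis using that[of y 1] y(1) True zy by auto
  next
    case False
    have "qbound A (- qform A z)"
      unfolding qbound_def
    proof
      fix x :: "real^'n"
      have "qform A y * (x \<bullet> x) \<le> - qform A z * (x \<bullet> x)" using False by (intro mult_right_mono) auto
      then show "\<bar>qform A x\<bar> \<le> - qform A z * (x \<bullet> x)" using y(2)[of x] z(2)[of x]
        by (auto simp: qform_minus)
    qed
    then show ?thesis using that[of z "-1"] z(1) False zy by auto
  qed
qed

section \<open>Eigenvalues of symmetric matrices and Schur stability\<close>

lemma real_eigenvector_imp_eigenvalue:
  fixes A :: "real^'n^'n"
  assumes "A *v x = r *\<^sub>R x" "x \<noteq> 0"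
  shows "eigenvalue (map_matrix complex_of_real A) (of_real r)"
proof -
  let ?v = "(\<chi> i. complex_of_real (x $ i)) :: complex^'n"
  have "map_matrix complex_of_real A *v ?v = complex_of_real r *s ?v"
  proof (simp add: vec_eq_iff matrix_vector_mult_def map_matrix_def, rule)
    fix i
    have "(\<Sum>j\<in>UNIV. A $ i $ j * x $ j) = r * x $ i"
      using arg_cong[OF assms(1), of "\<lambda>v. v $ i"] by (simp add: matrix_vector_mult_def)
    then show "(\<Sum>j\<in>UNIV. complex_of_real (A $ i $ j) * complex_of_real (x $ j)) =
        complex_of_real r * complex_of_real (x $ i)"
      by (metis (mono_tags, lifting) of_real_mult of_real_sum sum.cong)
  qed
  moreover have "?v \<noteq> 0" using assms(2) by (simp add: vec_eq_iff)
  ultimately show ?thesis unfolding eigenvalue_def by blast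
qed

text \<open>Write an eigenvector as \<open>a\<close> + i \<open>b\<close> with real parts
  \<open>a\<close>, \<open>b\<close>. Symmetry equates \<open>b \<bullet> (A *v a)\<close> and
  \<open>a \<bullet> (A *v b)\<close>, which forces \<open>Im z = 0\<close>. Adding the two forms
  avoids deciding which of \<open>a\<close>, \<open>b\<close> is nonzero.\<close>

lemma eigenvalue_sym_mat:
  fixes A :: "real^'n^'n"
  assumes A: "A \<in> sym_mats" and "eigenvalue (map_matrix complex_of_real A) z"
  obtains a b where "z = of_real (Re z)" "a \<noteq> 0 \<or> b \<noteq> 0"
    "qform A a + qform A b = Re z * (a \<bullet> a + b \<bullet> b)"
proof -
  obtain v where v: "v \<noteq> 0" "map_matrix complex_of_real A *v v = z *s v"
    using assms(2) by (auto simp: eigenvalue_def)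
  define a where "a = (\<chi> i. Re (v $ i))"
  define b where "b = (\<chi> i. Im (v $ i))"
  have vi: "(\<Sum>j\<in>UNIV. complex_of_real (A $ i $ j) * v $ j) = z * v $ i" for i
    using arg_cong[OF v(2), of "\<lambda>v. v $ i"] by (simp add: matrix_vector_mult_def map_matrix_def)
  have Aa: "A *v a = Re z *\<^sub>R a - Im z *\<^sub>R b"
    using vi[THEN arg_cong[where f=Re]] by (simp add: vec_eq_iff a_def b_def matrix_vector_mult_def)
  have Ab: "A *v b = Re z *\<^sub>R b + Im z *\<^sub>R a"
    using vi[THEN arg_cong[where f=Im]] by (simp add: vec_eq_iff a_def b_def matrix_vector_mult_def)
  have ne: "a \<noteq> 0 \<or> b \<noteq> 0"
    using v(1) by (auto simp: vec_eq_iff a_def b_def complex_eq_iff)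
  have "b \<bullet> (A *v a) = a \<bullet> (A *v b)" using sym_inner[OF A] by (metis inner_commute)
  then have "Im z * (a \<bullet> a + b \<bullet> b) = 0"
    by (simp add: Aa Ab inner_diff_right inner_add_right inner_commute algebra_simps)
  moreover have "a \<bullet> a + b \<bullet> b \<noteq> 0"
    using ne by (metis add_nonneg_eq_0_iff inner_eq_zero_iff inner_ge_zero)
  ultimately have "z = of_real (Re z)" by (simp add: complex_eq_iff)
  moreover have "qform A a + qform A b = Re z * (a \<bullet> a + b \<bullet> b)"
    by (simp add: qform_def Aa Ab inner_diff_right inner_add_right inner_commute algebra_simps)
  ultimately show ?thesis using that ne by blast
qed

text \<open>The matrix \<open>e *\<^sub>R (qform A z *\<^sub>R mat 1 - A)\<close> is positive
  semidefinite by maximality and its form vanishes at \<open>z\<close>, so \<open>z\<close> lies in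
  its kernel.\<close>

lemma eigenvector_of_abs_max:
  fixes A :: "real^'n^'n"
  assumes A: "A \<in> sym_mats" and z: "z \<bullet> z = 1" "e \<in> {1, -1::real}" "qbound A (e * qform A z)"
  shows "A *v z = qform A z *\<^sub>R z"
proof -
  let ?B = "qform A z *\<^sub>R mat 1 - A"
  have "psd (e *\<^sub>R ?B)"
    unfolding psd_def
  proof
    fix x :: "real^'n"
    have "\<bar>qform A x\<bar> \<le> e * qform A z * (x \<bullet> x)" using z(3) by (simp add: qbound_def)
    then show "0 \<le> qform (e *\<^sub>R ?B) x"
      using z(2) by (auto simp: qform_scaleR qform_diff)
  qed
  moreover have "e *\<^sub>R ?B \<in> sym_mats"
    by (intro subspace_mul subspace_diff subspace_sym_mats A mat_sym_mats)
  moreover have "qform (e *\<^sub>R ?B) z = 0" using z(1) by (simp add: qform_scaleR qform_diff)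
  ultimately have "(e *\<^sub>R ?B) *v z = 0" by (metis psd_null_vector)
  then have "e *\<^sub>R (qform A z *\<^sub>R z - A *v z) = 0"
    by (simp only: scaleR_matrix_vector_assoc[symmetric] matrix_vector_mult_diff_rdistrib
        matrix_vector_mul_lid)
  then show ?thesis using z(2) by auto
qed

text \<open>The extreme value of the form is an eigenvalue, which bounds the form if
  \<open>A\<close> is stable. Conversely an eigenvalue is real, and its multiple of
  \<open>a \<bullet> a + b \<bullet> b\<close> is a sum of two values of the form.\<close>

lemma schur_stable_sym_iff:
  fixes A :: "real^'n^'n"
  assumes A: "A \<in> sym_mats"
  shows "schur_stable A \<longleftrightarrow> (\<forall>x. x \<noteq> 0 \<longrightarrow> \<bar>qform A x\<bar> < x \<bullet> x)"
proof
  assume S: "schur_stable A"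
  obtain z e where z: "z \<bullet> z = 1" "e \<in> {1, -1::real}" "0 \<le> e * qform A z" "qbound A (e * qform A z)"
    using abs_qform_attains_max[of A] by blast
  have "z \<noteq> 0" using z(1) by auto
  then have "cmod (of_real (qform A z)) < 1"
    using S eigenvector_of_abs_max[OF A z(1,2,4)] real_eigenvector_imp_eigenvalue
    unfolding schur_stable_def by blast
  then have lt: "e * qform A z < 1" using z(2) by auto
  show "\<forall>x. x \<noteq> 0 \<longrightarrow> \<bar>qform A x\<bar> < x \<bullet> x"
  proof (intro allI impI)
    fix x :: "real^'n" assume "x \<noteq> 0"
    then have "x \<bullet> x > 0" by simp
    then have "e * qform A z * (x \<bullet> x) < 1 * (x \<bullet> x)" using lt by (intro mult_strict_right_mono)
    moreover have "\<bar>qform A x\<bar> \<le> e * qform A z * (x \<bullet> x)" using z(4) by (simp add: qbound_def)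
    ultimately show "\<bar>qform A x\<bar> < x \<bullet> x" by simp
  qed
next
  assume Q: "\<forall>x. x \<noteq> 0 \<longrightarrow> \<bar>qform A x\<bar> < x \<bullet> x"
  show "schur_stable A"
    unfolding schur_stable_def
  proof (intro allI impI)
    fix z assume "eigenvalue (map_matrix complex_of_real A) z"
    then obtain a b where ab: "z = of_real (Re z)" "a \<noteq> 0 \<or> b \<noteq> 0"
      "qform A a + qform A b = Re z * (a \<bullet> a + b \<bullet> b)"
      using eigenvalue_sym_mat[OF A] by blast
    \<comment> \<open>One of \<open>a\<close>, \<open>b\<close> may be zero, where only the weak
      inequality holds.\<close>
    have le: "\<bar>qform A x\<bar> \<le> x \<bullet> x" for x
      using Q by (cases "x = 0") (auto simp: qform_def intro: less_imp_le)
    have "\<bar>qform A a + qform A b\<bar> < a \<bullet> a + b \<bullet> b"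
      using ab(2) Q le[of a] le[of b] by (smt (verit))
    then have "\<bar>Re z\<bar> * (a \<bullet> a + b \<bullet> b) < 1 * (a \<bullet> a + b \<bullet> b)"
      unfolding ab(3) by (simp add: abs_mult)
    then have "\<bar>Re z\<bar> < 1"
      by (rule mult_right_less_imp_less) simp
    then show "cmod z < 1" by (metis ab(1) norm_of_real)
  qed
qed

text \<open>The stable symmetric matrices form the open unit ball, and a closed ball is the
  intersection of the larger open balls. So the norm can be read off from Schur stability of
  multiples.\<close>

lemma qbound_iff_schur_stable:
  fixes A :: "real^'n^'n"
  assumes A: "A \<in> sym_mats" and r: "0 \<le> r"
  shows "qbound A r \<longleftrightarrow> (\<forall>s>r. schur_stable ((1/s) *\<^sub>R A))"
proof -
  have "schur_stable ((1/s) *\<^sub>R A) \<longleftrightarrow> (\<forall>x. x \<noteq> 0 \<longrightarrow> \<bar>qform A x\<bar> < s * (x \<bullet> x))" if "s > r" for s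
  proof -
    have "(1/s) *\<^sub>R A \<in> sym_mats" by (intro subspace_mul subspace_sym_mats A)
    then show ?thesis using that r by (simp add: schur_stable_sym_iff qform_scaleR abs_mult field_simps)
  qed
  moreover have "qbound A r \<longleftrightarrow> (\<forall>s>r. \<forall>x. x \<noteq> 0 \<longrightarrow> \<bar>qform A x\<bar> < s * (x \<bullet> x))"
  proof (intro iffI allI impI)
    fix s :: real and x :: "real^'n" assume "qbound A r" "s > r" "x \<noteq> 0"
    then have "\<bar>qform A x\<bar> \<le> r * (x \<bullet> x)" "r * (x \<bullet> x) < s * (x \<bullet> x)"
      by (auto simp: qbound_def)
    then show "\<bar>qform A x\<bar> < s * (x \<bullet> x)" by simp
  next
    assume *: "\<forall>s>r. \<forall>x. x \<noteq> 0 \<longrightarrow> \<bar>qform A x\<bar> < s * (x \<bullet> x)"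
    show "qbound A r" unfolding qbound_def
    proof
      fix x :: "real^'n"
      show "\<bar>qform A x\<bar> \<le> r * (x \<bullet> x)"
      proof (cases "x = 0")
        case True then show ?thesis by (simp add: qform_def)
      next
        case False
        have "\<bar>qform A x\<bar> / (x \<bullet> x) \<le> s" if "s > r" for s
          using * that False by (simp add: field_simps less_imp_le)
        then have "\<bar>qform A x\<bar> / (x \<bullet> x) \<le> r" by (rule dense_ge)
        then show ?thesis using False by (simp add: field_simps)
      qed
    qed
  qed
  ultimately show ?thesis by blast
qed

section \<open>Symmetric matrix units\<close>

lemma symprod_commute: "symprod x y = symprod y x"
  by (simp add: symprod_def vec_eq_iff algebra_simps)

lemma symprod_add_left: "symprod (x + y) z = symprod x z + symprod y z"
  by (simp add: symprod_def vec_eq_iff algebra_simps add_divide_distrib)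

lemma symprod_scaleR_left: "symprod (c *\<^sub>R x) z = c *\<^sub>R symprod x z"
  by (simp add: symprod_def vec_eq_iff algebra_simps add_divide_distrib)

lemma symprod_scaleR_right: "symprod z (c *\<^sub>R x) = c *\<^sub>R symprod z x"
  by (metis symprod_scaleR_left symprod_commute)

lemma symprod_add_self:
  "symprod (x + y) (x + y) = symprod x x + symprod y y + 2 *\<^sub>R symprod x y"
  by (simp add: symprod_def vec_eq_iff field_simps)

abbreviation symunit :: "'n \<Rightarrow> 'n \<Rightarrow> real^'n^'n" where
  "symunit i j \<equiv> symprod (axis i 1) (axis j 1)"

lemma qform_symunit: "qform (symunit i j) x = x $ i * x $ j"
  by (simp add: qform_symprod inner_axis')

lemma symunit_nth:
  "symunit i j $ k $ l = (of_bool (k = i \<and> l = j) + of_bool (l = i \<and> k = j)) / 2"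
  by (auto simp: symprod_def axis_def)

lemma sym_mat_nth_commute: "A \<in> sym_mats \<Longrightarrow> A $ i $ j = A $ j $ i"
  by (metis (mono_tags, lifting) mem_Collect_eq sym_mats_def transpose_def vec_lambda_beta)

text \<open>The sum runs over ordered pairs, so each off-diagonal unit occurs twice, which makes up
  for its entries 1/2.\<close>

lemma sym_mat_eq_sum_symunit:
  assumes "A \<in> sym_mats"
  shows "A = (\<Sum>i\<in>UNIV. \<Sum>j\<in>UNIV. A $ i $ j *\<^sub>R symunit i j)"
proof -
  have "(\<Sum>i\<in>UNIV. \<Sum>j\<in>UNIV. A $ i $ j *\<^sub>R symunit i j) $ k $ l = A $ k $ l" for k l
  proof -
    have "(\<Sum>i\<in>UNIV. \<Sum>j\<in>UNIV. A $ i $ j *\<^sub>R symunit i j) $ k $ l =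
        (\<Sum>i\<in>UNIV. \<Sum>j\<in>UNIV. (if j = l then if i = k then A $ k $ l / 2 else 0 else 0)
          + (if j = k then if i = l then A $ l $ k / 2 else 0 else 0))"
      by (auto simp: symunit_nth intro!: sum.cong)
    also have "\<dots> = A $ k $ l / 2 + A $ l $ k / 2"
      by (simp add: sum.distrib)
    also have "\<dots> = A $ k $ l"
      using sym_mat_nth_commute[OF assms, of l k] by simp
    finally show ?thesis .
  qed
  then show ?thesis by (simp add: vec_eq_iff)
qed

section \<open>Order isomorphisms that fix the diagonal units\<close>

text \<open>The vectors e_i + e_j and e_i - e_j bound \<open>s\<close> from both sides; the converse
  is the inequality between arithmetic and geometric means. Positivity thus detects the size of an
  off-diagonal entry.\<close>

lemma psd_symunit_iff:
  fixes i j :: "'n::finite"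
  assumes "i \<noteq> j"
  shows "psd (symunit i i + symunit j j + (2 * s) *\<^sub>R symunit i j) \<longleftrightarrow> \<bar>s\<bar> \<le> 1"
proof -
  have q: "qform (symunit i i + symunit j j + (2 * s) *\<^sub>R symunit i j) x =
      x $ i * x $ i + x $ j * x $ j + 2 * s * (x $ i * x $ j)" for x :: "real^'n"
    by (simp add: qform_add qform_scaleR qform_symunit)
  show ?thesis
  proof
    assume *: "psd (symunit i i + symunit j j + (2 * s) *\<^sub>R symunit i j)"
    show "\<bar>s\<bar> \<le> 1"
      using *[unfolded psd_def q, rule_format, of "axis i 1 + axis j 1"]
        *[unfolded psd_def q, rule_format, of "axis i 1 - axis j 1"] assms
      by (simp add: axis_def)
  next
    assume s: "\<bar>s\<bar> \<le> 1"
    show "psd (symunit i i + symunit j j + (2 * s) *\<^sub>R symunit i j)"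
      unfolding psd_def q
    proof
      fix x :: "real^'n"
      have "\<bar>s * (x $ i * x $ j)\<bar> \<le> 1 * \<bar>x $ i * x $ j\<bar>"
        unfolding abs_mult[of s] using s by (intro mult_right_mono) auto
      moreover have "2 * \<bar>x $ i * x $ j\<bar> \<le> x $ i * x $ i + x $ j * x $ j"
        using sum_squares_bound[of "\<bar>x $ i\<bar>" "\<bar>x $ j\<bar>"]
        by (simp add: abs_mult power2_eq_square)
      ultimately show "0 \<le> x $ i * x $ i + x $ j * x $ j + 2 * s * (x $ i * x $ j)" by linarith
    qed
  qed
qed

text \<open>Positive images of rank-one matrices kill every entry of \<open>M (symunit i j)\<close>
  but the two at (i, j) and (j, i). Preserving positivity in both directions then leaves only a
  sign.\<close>

lemma order_iso_fixing_diagonal_symunit: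
  fixes M :: "real^'n^'n \<Rightarrow> real^'n^'n"
  assumes lin: "linear M" and sym: "\<And>A. A \<in> sym_mats \<Longrightarrow> M A \<in> sym_mats"
    and psd: "\<And>A. A \<in> sym_mats \<Longrightarrow> psd (M A) \<longleftrightarrow> psd A"
    and diag: "\<And>i. M (symunit i i) = symunit i i"
    and ij: "i \<noteq> j"
  obtains t where "t \<in> {1, -1}" "M (symunit i j) = t *\<^sub>R symunit i j"
proof -
  define T where "T = M (symunit i j)"
  have T: "T \<in> sym_mats" by (simp add: T_def sym)
  have pos: "0 \<le> a * a * (x $ i * x $ i) + b * b * (x $ j * x $ j) + 2 * a * b * qform T x" for a b x
  proof -
    let ?u = "a *\<^sub>R axis i 1 + b *\<^sub>R axis j 1 :: real^'n"
    have "symprod ?u ?u = (a * a) *\<^sub>R symunit i i + (b * b) *\<^sub>R symunit j j + (2 * a * b) *\<^sub>R symunit i j"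
      by (simp add: symprod_add_self symprod_scaleR_left symprod_scaleR_right mult_ac)
    then have "M (symprod ?u ?u) = (a * a) *\<^sub>R symunit i i + (b * b) *\<^sub>R symunit j j + (2 * a * b) *\<^sub>R T"
      by (simp add: linear_add[OF lin] linear_cmul[OF lin] diag T_def)
    moreover have "psd (M (symprod ?u ?u))" by (simp add: psd psd_symprod_self)
    ultimately show ?thesis
      by (simp add: psd_def qform_add qform_scaleR qform_symunit)
  qed
  have Tii: "T $ i $ i = 0"
  proof (rule ccontr)
    \<comment> \<open>At e_i with \<open>a = 1\<close> the inequality reads
      \<open>0 \<le> 1 + 2 * b * T $ i $ i\<close>; the chosen \<open>b\<close> makes the right side
      -1.\<close>
    assume "T $ i $ i \<noteq> 0"
    then show False
      using pos[of 1 "axis i 1" "- 1 / T $ i $ i"] ij by (simp add: qform_axis, simp add: axis_def)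
  qed
  have Tjj: "T $ j $ j = 0"
  proof (rule ccontr)
    assume "T $ j $ j \<noteq> 0"
    then show False
      using pos[of "- 1 / T $ j $ j" "axis j 1" 1] ij by (simp add: qform_axis, simp add: axis_def)
  qed
  have Tk: "T $ l $ k = 0" if k: "k \<noteq> i" "k \<noteq> j" for k l
  proof -
    \<comment> \<open>This is the image of the rank-one matrix of e_i + e_j. Its form vanishes at
      e_k, so its whole column \<open>k\<close> is zero.\<close>
    let ?B = "symunit i i + symunit j j + 2 *\<^sub>R T"
    have "T $ k $ k = 0"
      using pos[of 1 "axis k 1" 1] pos[of 1 "axis k 1" "-1"] k by (simp add: qform_axis, simp add: axis_def)
    then have "qform ?B (axis k 1) = 0"
      using k by (simp add: qform_axis symunit_nth)
    moreover have "psd ?B" using pos[of 1 _ 1] by (simp add: psd_def qform_add qform_scaleR qform_symunit)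
    moreover have "?B \<in> sym_mats"
      by (intro subspace_add subspace_mul subspace_sym_mats T symprod_sym_mats)
    ultimately have "?B *v axis k 1 = 0" by (metis psd_null_vector)
    then have "?B $ l $ k = 0" by (simp add: matrix_vector_mult_basis column_def vec_eq_iff)
    then show ?thesis using k by (simp add: symunit_nth)
  qed
  \<comment> \<open>The factor 2 offsets the entry 1/2 of \<open>symunit i j\<close>.\<close>
  define t where "t = 2 * T $ i $ j"
  have "T $ k $ l = (t *\<^sub>R symunit i j) $ k $ l" for k l
    using Tk[of k l] Tk[of l k] Tii Tjj ij sym_mat_nth_commute[OF T]
    by (cases "k = i"; cases "k = j"; cases "l = i"; cases "l = j") (auto simp: symunit_nth t_def)
  then have Tt: "T = t *\<^sub>R symunit i j" by (simp add: vec_eq_iff)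
  have iff: "\<bar>s * t\<bar> \<le> 1 \<longleftrightarrow> \<bar>s\<bar> \<le> 1" for s
  proof -
    have "M (symunit i i + symunit j j + (2 * s) *\<^sub>R symunit i j) =
        symunit i i + symunit j j + (2 * (s * t)) *\<^sub>R symunit i j"
      using Tt by (simp add: linear_add[OF lin] linear_cmul[OF lin] diag T_def)
    moreover have "symunit i i + symunit j j + (2 * s) *\<^sub>R symunit i j \<in> sym_mats"
      by (intro subspace_add subspace_mul subspace_sym_mats symprod_sym_mats)
    ultimately show ?thesis using psd psd_symunit_iff[OF ij] by metis
  qed
  \<comment> \<open>\<open>s = 1\<close> bounds \<open>t\<close> above, \<open>s = 2\<close>
    excludes \<open>t = 0\<close>, and \<open>s = 1/t\<close> bounds \<open>t\<close> away from
    0.\<close>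
  have "\<bar>t\<bar> \<le> 1" using iff[of 1] by simp
  moreover have "t \<noteq> 0" using iff[of 2] by auto
  moreover have "\<bar>1 / t\<bar> \<le> 1" using iff[of "1/t"] \<open>t \<noteq> 0\<close> by simp
  ultimately have "t \<in> {1, -1}" by (auto simp: field_simps abs_if split: if_splits)
  then show ?thesis using that Tt by (simp add: T_def)
qed

text \<open>The signs \<open>t i j\<close> satisfy a cocycle identity, so any one row
  \<open>t k\<close> of them serves as the vector \<open>s\<close>.\<close>

lemma order_iso_fixing_diagonal:
  fixes M :: "real^'n^'n \<Rightarrow> real^'n^'n"
  assumes lin: "linear M" and sym: "\<And>A. A \<in> sym_mats \<Longrightarrow> M A \<in> sym_mats"
    and psd: "\<And>A. A \<in> sym_mats \<Longrightarrow> psd (M A) \<longleftrightarrow> psd A"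
    and diag: "\<And>i. M (symunit i i) = symunit i i"
  obtains s where "\<And>i. s i \<in> {1, -1}"
    "\<And>A. A \<in> sym_mats \<Longrightarrow> M A = (\<chi> k l. s k * s l * A $ k $ l)"
proof -
  have "\<exists>t. t \<in> {1, -1} \<and> (i = j \<longrightarrow> t = 1) \<and> M (symunit i j) = t *\<^sub>R symunit i j" for i j
  proof (cases "i = j")
    case True then show ?thesis by (intro exI[of _ 1]) (simp add: diag)
  next
    case False
    then show ?thesis using order_iso_fixing_diagonal_symunit[OF assms False] by metis
  qed
  then obtain t where t: "\<And>i j. t i j \<in> {1, -1::real}" "\<And>i. t i i = 1"
      "\<And>i j. M (symunit i j) = t i j *\<^sub>R symunit i j"
    by metis
  have tsym: "t i j = t j i" for i j
  proof -
    have "t i j *\<^sub>R symunit i j = t j i *\<^sub>R symunit i j"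
      using t(3)[of i j] t(3)[of j i] by (simp add: symprod_commute)
    moreover have "symunit i j $ i $ j \<noteq> 0" by (simp add: symunit_nth)
    ultimately show ?thesis by (metis scaleR_cancel_right zero_index)
  qed
  have cocycle: "t i j = t k i * t k j" for i j k
  proof (cases "i = j \<or> i = k \<or> j = k")
    case True
    then show ?thesis using t(1)[of k i] by (auto simp: t(2) tsym)
  next
    case False
    define u :: "real^'n" where "u = axis k 1 + axis i 1 + axis j 1"
    \<comment> \<open>Chosen so that the image of \<open>symprod u u\<close> has value
      \<open>2 * t i j * t k i * t k j - 1\<close> at \<open>x\<close>; nonnegativity makes the
      product of the three signs 1.\<close>
    define x :: "real^'n" where
      "x = axis k 1 - t k i *\<^sub>R axis i 1 - t k j *\<^sub>R axis j 1"
    have x: "x $ k = 1" "x $ i = - t k i" "x $ j = - t k j"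
      using False by (auto simp: x_def axis_def)
    have "symprod u u = symunit k k + symunit i i + 2 *\<^sub>R symunit k i + symunit j j +
        2 *\<^sub>R (symunit k j + symunit i j)"
      by (simp only: u_def symprod_add_self symprod_add_left[of "axis k 1" "axis i 1" "axis j 1"])
    then have "M (symprod u u) = symunit k k + symunit i i + (2 * t k i) *\<^sub>R symunit k i + symunit j j +
        2 *\<^sub>R (t k j *\<^sub>R symunit k j + t i j *\<^sub>R symunit i j)"
      by (simp add: linear_add[OF lin] linear_cmul[OF lin] t(2,3))
    moreover have "psd (M (symprod u u))" by (simp add: psd psd_symprod_self)
    ultimately have "0 \<le> x $ k * x $ k + x $ i * x $ i + 2 * t k i * (x $ k * x $ i) + x $ j * x $ j +
        2 * (t k j * (x $ k * x $ j) + t i j * (x $ i * x $ j))"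
      by (simp add: psd_def qform_add qform_scaleR qform_symunit)
    then show ?thesis
      unfolding x using t(1)[of k i] t(1)[of k j] t(1)[of i j] by auto
  qed
  obtain k :: 'n where True by simp
  have "M A = (\<chi> p q. t k p * t k q * A $ p $ q)" if A: "A \<in> sym_mats" for A
  proof -
    let ?C = "(\<chi> p q. t k p * t k q * A $ p $ q) :: real^'n^'n"
    have C: "?C \<in> sym_mats"
      using sym_mat_nth_commute[OF A] by (simp add: sym_mats_def transpose_def vec_eq_iff)
    have C_nth: "A $ i $ j *\<^sub>R (t i j *\<^sub>R symunit i j) = ?C $ i $ j *\<^sub>R symunit i j" for i j
      using cocycle[of i j k] by simp
    have "M A = M (\<Sum>i\<in>UNIV. \<Sum>j\<in>UNIV. A $ i $ j *\<^sub>R symunit i j)"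
      using sym_mat_eq_sum_symunit[OF A] by simp
    also have "\<dots> = (\<Sum>i\<in>UNIV. \<Sum>j\<in>UNIV. ?C $ i $ j *\<^sub>R symunit i j)"
      by (simp only: linear_sum[OF lin] linear_cmul[OF lin] t(3) C_nth)
    also have "\<dots> = ?C" by (rule sym_mat_eq_sum_symunit[OF C, symmetric])
    finally show ?thesis .
  qed
  then show ?thesis using that[of "t k"] t(1) by blast
qed

section \<open>Order isomorphisms that fix the identity\<close>

text \<open>\<open>f i\<close> is a unit vector where the form of \<open>L (symunit i i)\<close>
  takes its maximum, which turns out to be 1. Orthogonality holds because \<open>f j\<close> and
  \<open>f i\<close> are eigenvectors of the symmetric matrix \<open>L (symunit j j)\<close> for 1
  and 0.\<close>

lemma order_iso_frame:
  fixes L :: "real^'n^'n \<Rightarrow> real^'n^'n"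
  assumes lin: "linear L" and sym: "\<And>A. A \<in> sym_mats \<Longrightarrow> L A \<in> sym_mats"
    and psd: "\<And>A. A \<in> sym_mats \<Longrightarrow> psd (L A) \<longleftrightarrow> psd A"
    and unit: "L (mat 1) = mat 1"
  obtains f :: "'n \<Rightarrow> real^'n" where "\<And>i j. f i \<bullet> f j = (if i = j then 1 else 0)"
    "\<And>i j. L (symunit i i) *v f j = (if i = j then f j else 0)"
proof -
  let ?F = "\<lambda>i. L (symunit i i)"
  note closed = subspace_add[OF subspace_sym_mats] subspace_diff[OF subspace_sym_mats]
    subspace_mul[OF subspace_sym_mats]
  have F_psd: "psd (?F i)" for i by (simp add: psd psd_symprod_self)
  have "psd (mat 1 - symunit i i)" for i :: 'n
    unfolding psd_def
  proof
    fix x :: "real^'n"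
    have "\<bar>x $ i\<bar>\<^sup>2 \<le> (norm x)\<^sup>2" by (intro power_mono component_le_norm_cart) auto
    then show "0 \<le> qform (mat 1 - symunit i i) x"
      by (simp add: qform_diff qform_symunit dot_square_norm power2_eq_square)
  qed
  then have "psd (L (mat 1 - symunit i i))" for i by (simp add: psd closed)
  then have I_F: "psd (mat 1 - ?F i)" for i by (simp add: linear_diff[OF lin] unit)
  have "psd (mat 1 - symunit i i - symunit j j)" if "i \<noteq> j" for i j :: 'n
    unfolding psd_def
  proof
    fix x :: "real^'n"
    have "(\<Sum>k\<in>{i, j}. x $ k * x $ k) \<le> (\<Sum>k\<in>UNIV. x $ k * x $ k)" by (intro sum_mono2) auto
    then show "0 \<le> qform (mat 1 - symunit i i - symunit j j) x"
      using that by (simp add: qform_diff qform_symunit inner_vec_def)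
  qed
  then have "psd (L (mat 1 - symunit i i - symunit j j))" if "i \<noteq> j" for i j
    using that by (simp add: psd closed)
  then have I_FF: "psd (mat 1 - ?F i - ?F j)" if "i \<noteq> j" for i j
    using that by (simp add: linear_diff[OF lin] unit)
  have "\<exists>z. z \<bullet> z = 1 \<and> qform (?F i) z = 1" for i
  proof -
    obtain z where z: "z \<bullet> z = 1" "\<And>x. qform (?F i) x \<le> qform (?F i) z * (x \<bullet> x)"
      using qform_attains_max[of "?F i"] by blast
    let ?r = "qform (?F i) z"
    \<comment> \<open>Positivity is pulled back through \<open>L\<close> here: the preimage is
      positive semidefinite, and its value \<open>?r - 1\<close> at e_i bounds the maximum
      below.\<close>
    have "L (?r *\<^sub>R mat 1 - symunit i i) = ?r *\<^sub>R mat 1 - ?F i"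
      by (simp add: linear_diff[OF lin] linear_cmul[OF lin] unit)
    moreover have "psd (?r *\<^sub>R mat 1 - ?F i)" using z(2) by (simp add: psd_def qform_diff qform_scaleR)
    ultimately have "psd (?r *\<^sub>R mat 1 - symunit i i)" using psd by (metis closed(2,3) mat_sym_mats symprod_sym_mats)
    then have "0 \<le> qform (?r *\<^sub>R mat 1 - symunit i i) (axis i 1)" by (simp add: psd_def)
    then have "1 \<le> ?r" by (simp add: qform_diff qform_scaleR qform_symunit inner_axis_axis)
    moreover have "0 \<le> qform (mat 1 - ?F i) z" using I_F by (simp add: psd_def)
    ultimately show ?thesis using z(1) by (intro exI[of _ z]) (simp add: qform_diff)
  qed
  then obtain f where f: "\<And>i. f i \<bullet> f i = 1" "\<And>i. qform (?F i) (f i) = 1" by metis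
  have Fii: "?F i *v f i = f i" for i
  proof -
    have "(mat 1 - ?F i) *v f i = 0"
      by (intro psd_null_vector I_F closed sym) (simp_all add: qform_diff f)
    then show ?thesis by (simp add: matrix_vector_mult_diff_rdistrib)
  qed
  have Fij: "?F i *v f j = 0" if "i \<noteq> j" for i j
  proof (intro psd_null_vector F_psd sym symprod_sym_mats)
    \<comment> \<open>\<open>mat 1\<close> and \<open>?F j\<close> both take the value 1 at
      \<open>f j\<close>, so \<open>?F i\<close> has a value there that is at once nonpositive and
      nonnegative.\<close>
    have "0 \<le> qform (mat 1 - ?F i - ?F j) (f j)" "0 \<le> qform (?F i) (f j)"
      using I_FF[OF that] F_psd[of i] by (auto simp: psd_def)
    then show "qform (?F i) (f j) = 0" by (simp add: qform_diff f)
  qed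
  have "f i \<bullet> f j = 0" if "i \<noteq> j" for i j
  proof -
    have "f i \<bullet> f j = f i \<bullet> (?F j *v f j)" by (simp add: Fii)
    also have "\<dots> = (?F j *v f i) \<bullet> f j" by (intro sym_inner sym symprod_sym_mats)
    also have "\<dots> = 0" using that by (simp add: Fij)
    finally show ?thesis .
  qed
  then show ?thesis using that[of f] f(1) Fii Fij by simp
qed

text \<open>Passing to the orthonormal basis \<open>f\<close> turns \<open>L\<close> into a map
  \<open>M\<close> that fixes the diagonal units and hence is conjugation by a diagonal sign matrix
  \<open>D\<close>; then \<open>R = Q ** D\<close>.\<close>

lemma order_iso_is_congruence:
  fixes L :: "real^'n^'n \<Rightarrow> real^'n^'n"
  assumes lin: "linear L" and sym: "\<And>A. A \<in> sym_mats \<Longrightarrow> L A \<in> sym_mats"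
    and psd: "\<And>A. A \<in> sym_mats \<Longrightarrow> psd (L A) \<longleftrightarrow> psd A"
    and unit: "L (mat 1) = mat 1"
  obtains R where "orthogonal_matrix R" "\<And>A. A \<in> sym_mats \<Longrightarrow> L A = R ** A ** transpose R"
proof -
  obtain f where f: "\<And>i j. f i \<bullet> f j = (if i = j then 1 else 0)"
    "\<And>i j. L (symunit i i) *v f j = (if i = j then f j else 0)"
    using order_iso_frame[OF assms] by blast
  define Q :: "real^'n^'n" where "Q = (\<chi> k i. f i $ k)"
  have col: "column i Q = f i" for i by (simp add: column_def Q_def vec_eq_iff)
  have entry: "(transpose Q ** A ** Q) $ k $ l = f k \<bullet> (A *v f l)" for A k l
  proof -
    have "(transpose Q ** A ** Q) $ k $ l = ((transpose Q ** A ** Q) *v axis l 1) $ k"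
      by (simp add: matrix_vector_mult_basis column_def)
    also have "\<dots> = (transpose Q *v (A *v f l)) $ k"
      by (simp only: matrix_vector_mul_assoc[symmetric]) (simp only: matrix_vector_mult_basis col)
    also have "\<dots> = f k \<bullet> (A *v f l)"
      by (simp only: matrix_vector_mult_def[of "transpose Q"])
        (simp add: transpose_def Q_def inner_vec_def)
    finally show ?thesis .
  qed
  have "(transpose Q ** Q) $ k $ l = (if k = l then 1 else 0)" for k l
    using entry[of "mat 1" k l] by (simp add: f(1))
  then have "transpose Q ** Q = mat 1"
    by (simp add: vec_eq_iff mat_def)
  then have Q: "orthogonal_matrix Q" by (simp add: orthogonal_matrix)
  then have QQ: "Q ** transpose Q = mat 1" by (simp add: orthogonal_matrix_def)
  define M where "M A = transpose Q ** L A ** Q" for A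
  have M_lin: "linear M"
    by (rule linearI)
      (simp_all add: vec_eq_iff M_def entry linear_add[OF lin] linear_cmul[OF lin]
        matrix_vector_mult_add_rdistrib inner_add_right flip: scaleR_matrix_vector_assoc)
  have M_sym: "M A \<in> sym_mats" if "A \<in> sym_mats" for A
    unfolding M_def by (intro congruence_sym_mats sym that)
  have M_psd: "psd (M A) \<longleftrightarrow> psd A" if "A \<in> sym_mats" for A
  proof -
    have "Q *v (transpose Q *v x) = x" for x
      by (simp only: matrix_vector_mul_assoc QQ matrix_vector_mul_lid)
    then have "psd (M A) \<longleftrightarrow> psd (L A)"
      unfolding psd_def M_def qform_congruence by metis
    then show ?thesis using psd[OF that] by simp
  qed
  have M_diag: "M (symunit i i) = symunit i i" for i
    by (auto simp: vec_eq_iff M_def entry f symunit_nth)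
  obtain s where s: "\<And>i. s i \<in> {1, -1}"
    "\<And>A. A \<in> sym_mats \<Longrightarrow> M A = (\<chi> k l. s k * s l * A $ k $ l)"
    using order_iso_fixing_diagonal[OF M_lin M_sym M_psd M_diag] by blast
  define D :: "real^'n^'n" where "D = (\<chi> i j. if i = j then s i else 0)"
  have Dt: "transpose D = D" by (auto simp: D_def transpose_def vec_eq_iff)
  have ss: "s i * s i = 1" for i using s(1)[of i] by auto
  have DAD: "D ** A ** D = (\<chi> k l. s k * s l * A $ k $ l)" for A :: "real^'n^'n"
    by (simp add: D_def vec_eq_iff matrix_matrix_mult_def if_distrib if_distribR cong: if_cong)
  have "D ** D = (\<chi> k l. s k * s l * (mat 1 :: real^'n^'n) $ k $ l)"
    using DAD[of "mat 1"] by simp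
  also have "\<dots> = mat 1" using ss by (simp add: vec_eq_iff mat_def)
  finally have "orthogonal_matrix D" by (simp add: orthogonal_matrix Dt)
  then have "orthogonal_matrix (Q ** D)" using Q by (rule orthogonal_matrix_mul[rotated])
  moreover have "L A = (Q ** D) ** A ** transpose (Q ** D)" if "A \<in> sym_mats" for A
  proof -
    have "L A = (Q ** transpose Q) ** L A ** (Q ** transpose Q)" by (simp add: QQ)
    also have "\<dots> = Q ** M A ** transpose Q" by (simp add: M_def matrix_mul_assoc)
    also have "\<dots> = Q ** (D ** A ** D) ** transpose Q" by (simp add: s(2)[OF that] DAD)
    finally show ?thesis by (simp add: matrix_mul_assoc matrix_transpose_mul Dt)
  qed
  ultimately show ?thesis using that by blast
qed

section \<open>The image of the identity under an isometry\<close>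

lemma abs_qform_eq_imp_unit:
  fixes U :: "real^'n^'n"
  assumes U: "U \<in> sym_mats" and abs: "\<And>x. \<bar>qform U x\<bar> = x \<bullet> x"
  obtains c where "c \<in> {1, -1}" "U = c *\<^sub>R mat 1"
proof -
  have two: "U $ i $ j = 0 \<and> U $ i $ i = U $ j $ j" if "i \<noteq> j" for i j
  proof -
    have q: "\<bar>a\<^sup>2 * U $ i $ i + 2 * a * U $ i $ j + U $ j $ j\<bar> = a\<^sup>2 + 1" for a
    proof -
      have "qform U (a *\<^sub>R axis i 1 + axis j 1) = a\<^sup>2 * U $ i $ i + 2 * a * U $ i $ j + U $ j $ j"
        using sym_mat_nth_commute[OF U, of i j]
        by (simp add: qform_arg_add[OF U] qform_arg_scaleR qform_axis matrix_vector_mult_scaleR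
            inner_axis' matrix_vector_mult_basis column_def)
      moreover have "(a *\<^sub>R axis i 1 + axis j 1 :: real^'n) \<bullet> (a *\<^sub>R axis i 1 + axis j 1) = a\<^sup>2 + 1"
        using that by (simp add: inner_add inner_axis_axis power2_eq_square)
      ultimately show ?thesis using abs by metis
    qed
    show ?thesis
      \<comment> \<open>The values 0, 1 and -1 of \<open>a\<close> still allow diagonal entries 1
        and -1 with an off-diagonal entry 1 or -1; \<open>a = 2\<close> rules this out.\<close>
      using q[of 0] q[of 1] q[of "-1"] q[of 2] abs[of "axis i 1"]
      by (simp add: qform_axis inner_axis_axis) linarith
  qed
  obtain k :: 'n where True by simp
  have "U $ i $ i = U $ k $ k" for i using two by (cases "i = k") auto
  then have "U = U $ k $ k *\<^sub>R mat 1"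
    using two by (simp add: vec_eq_iff mat_def)
  moreover have "U $ k $ k \<in> {1, -1}"
    using abs[of "axis k 1"] by (auto simp: qform_axis inner_axis_axis)
  ultimately show ?thesis using that by blast
qed

text \<open>For a unit vector \<open>x\<close>, take the preimage \<open>A\<close> of
  \<open>symprod x x\<close>. Adding it to the identity with the right sign gives norm at least 2,
  hence so does adding \<open>symprod x x\<close> with that sign to \<open>L (mat 1)\<close>. Each
  summand has norm at most 1, so both are extremal at a common vector, which must be
  \<open>x\<close> or \<open>- x\<close>.\<close>

lemma isometry_unit:
  fixes L :: "real^'n^'n \<Rightarrow> real^'n^'n"
  assumes lin: "linear L" and sym: "\<And>A. A \<in> sym_mats \<Longrightarrow> L A \<in> sym_mats"
    and bound: "\<And>A r. A \<in> sym_mats \<Longrightarrow> 0 \<le> r \<Longrightarrow> qbound (L A) r \<longleftrightarrow> qbound A r"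
    and onto: "\<And>B. B \<in> sym_mats \<Longrightarrow> \<exists>A\<in>sym_mats. L A = B"
  obtains c where "c \<in> {1, -1}" "L (mat 1) = c *\<^sub>R mat 1"
proof -
  let ?U = "L (mat 1)"
  note closed = subspace_add[OF subspace_sym_mats] subspace_mul[OF subspace_sym_mats]
  have "qbound (mat 1 :: real^'n^'n) 1" by (simp add: qbound_def)
  then have U1: "\<bar>qform ?U x\<bar> \<le> x \<bullet> x" for x
    using bound[of "mat 1" 1] by (simp add: qbound_def)
  have unit: "\<bar>qform ?U x\<bar> = 1" if x: "x \<bullet> x = 1" for x
  proof -
    let ?X = "symprod x x"
    obtain A where A: "A \<in> sym_mats" "L A = ?X" using onto symprod_sym_mats by blast
    have cs: "(x \<bullet> y)\<^sup>2 \<le> y \<bullet> y" for y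
      using Cauchy_Schwarz_ineq[of x y] x by simp
    obtain z e where z: "z \<bullet> z = 1" "e \<in> {1, -1::real}" "0 \<le> e * qform A z" "qbound A (e * qform A z)"
      using abs_qform_attains_max[of A] by blast
    have "qbound ?X 1"
      using cs by (simp add: qbound_def qform_symprod power2_eq_square)
    then have "qbound A 1" using bound[of A 1] A by simp
    then have "e * qform A z \<le> 1" using z(1,2) by (auto simp: qbound_def dest: spec[of _ z])
    moreover have "qbound ?X (e * qform A z)" using bound[OF A(1) z(3)] z(4) A(2) by simp
    then have "1 \<le> e * qform A z" using x by (auto simp: qbound_def qform_symprod dest: spec[of _ x])
    \<comment> \<open>\<open>A\<close> inherits norm 1 from \<open>symprod x x\<close>, attained at
      \<open>z\<close> with sign \<open>e\<close>.\<close>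
    ultimately have eA: "e * qform A z = 1" by simp
    let ?B = "mat 1 + e *\<^sub>R A"
    have LB: "L ?B = ?U + e *\<^sub>R ?X" using A(2) by (simp add: linear_add[OF lin] linear_cmul[OF lin])
    obtain y d where y: "y \<bullet> y = 1" "d \<in> {1, -1::real}" "0 \<le> d * qform (L ?B) y"
        "qbound (L ?B) (d * qform (L ?B) y)"
      using abs_qform_attains_max[of "L ?B"] by blast
    have "qbound ?B (d * qform (L ?B) y)"
      using bound[of ?B] y(3,4) A(1) by (simp add: closed)
    then have "\<bar>qform ?B z\<bar> \<le> d * qform (L ?B) y" using z(1) by (auto simp: qbound_def dest: spec[of _ z])
    then have "2 \<le> d * qform (L ?B) y" using eA z(1) by (simp add: qform_add qform_scaleR)
    then have "2 \<le> d * (qform ?U y + e * (x \<bullet> y)\<^sup>2)"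
      by (simp add: LB qform_add qform_scaleR qform_symprod power2_eq_square)
    moreover obtain p where p: "p = (x \<bullet> y)\<^sup>2" "0 \<le> p" by simp
    ultimately have "2 \<le> \<bar>qform ?U y\<bar> + (x \<bullet> y)\<^sup>2"
      unfolding p(1)[symmetric] using y(2) z(2) p(2) by auto
    then have eq: "\<bar>qform ?U y\<bar> = 1" "(x \<bullet> y)\<^sup>2 = 1"
      using U1[of y] cs[of y] y(1) by linarith+
    \<comment> \<open>Equality in Cauchy-Schwarz makes \<open>y\<close> a multiple of
      \<open>x\<close>.\<close>
    have "(y - (x \<bullet> y) *\<^sub>R x) \<bullet> (y - (x \<bullet> y) *\<^sub>R x) = 0"
      using x y(1) eq(2) by (simp add: inner_diff inner_commute[of y x] power2_eq_square)
    then have "y = (x \<bullet> y) *\<^sub>R x" by simp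
    then have "qform ?U y = (x \<bullet> y)\<^sup>2 * qform ?U x" by (metis qform_arg_scaleR)
    then show ?thesis using eq by simp
  qed
  have "\<bar>qform ?U x\<bar> = x \<bullet> x" for x
  proof (cases "x = 0")
    case True then show ?thesis by (simp add: qform_def)
  next
    case False
    then have "\<bar>qform ?U ((1 / norm x) *\<^sub>R x)\<bar> = 1"
      by (intro unit) (simp add: dot_square_norm power2_eq_square)
    then show ?thesis using False by (simp add: qform_arg_scaleR abs_mult dot_square_norm field_simps)
  qed
  then show ?thesis using abs_qform_eq_imp_unit[OF sym[OF mat_sym_mats]] that by blast
qed

section \<open>From isometries to order isomorphisms\<close>

text \<open>The values of the form on unit vectors lie in [-r, r], and such a value is nonnegative
  exactly if its distance from \<open>r\<close> is at most \<open>r\<close>. So the norm and the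
  identity determine the order.\<close>

lemma psd_iff_qbound:
  assumes "qbound A r"
  shows "psd A \<longleftrightarrow> qbound (r *\<^sub>R mat 1 - A) r"
proof -
  have "\<bar>qform A x\<bar> \<le> r * (x \<bullet> x)" for x using assms by (simp add: qbound_def)
  then have "0 \<le> qform A x \<longleftrightarrow> \<bar>r * (x \<bullet> x) - qform A x\<bar> \<le> r * (x \<bullet> x)" for x
    by (smt (verit))
  then show ?thesis by (simp add: psd_def qbound_def qform_diff qform_scaleR)
qed

lemma isometry_is_signed_congruence:
  fixes L :: "real^'n^'n \<Rightarrow> real^'n^'n"
  assumes lin: "linear L" and sym: "\<And>A. A \<in> sym_mats \<Longrightarrow> L A \<in> sym_mats"
    and bound: "\<And>A r. A \<in> sym_mats \<Longrightarrow> 0 \<le> r \<Longrightarrow> qbound (L A) r \<longleftrightarrow> qbound A r"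
    and onto: "\<And>B. B \<in> sym_mats \<Longrightarrow> \<exists>A\<in>sym_mats. L A = B"
  obtains R c where "orthogonal_matrix R" "c \<in> {1, -1}"
    "\<And>A. A \<in> sym_mats \<Longrightarrow> L A = c *\<^sub>R (R ** A ** transpose R)"
proof -
  obtain c where c: "c \<in> {1, -1}" "L (mat 1) = c *\<^sub>R mat 1" using isometry_unit[OF assms] by blast
  \<comment> \<open>Since \<open>c * c = 1\<close>, this sign change makes the identity a fixed
    point and keeps the norm.\<close>
  define K where "K A = c *\<^sub>R L A" for A
  have cc: "c * c = 1" using c(1) by auto
  have K1: "K (mat 1) = mat 1" by (simp add: K_def c(2) cc)
  have K: "linear K" unfolding K_def by (rule linear_compose_scale_right[OF lin])
  have Ksym: "K A \<in> sym_mats" if "A \<in> sym_mats" for A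
    unfolding K_def by (intro subspace_mul subspace_sym_mats sym that)
  have Kbound: "qbound (K A) r \<longleftrightarrow> qbound A r" if "A \<in> sym_mats" "0 \<le> r" for A r
    using bound[OF that] c(1) by (auto simp: K_def qbound_def qform_minus)
  have "psd (K A) \<longleftrightarrow> psd A" if A: "A \<in> sym_mats" for A
  proof -
    obtain r where r: "0 \<le> r" "qbound A r" using abs_qform_attains_max[of A] by blast
    have "r *\<^sub>R mat 1 - A \<in> sym_mats" by (intro subspace_diff subspace_mul subspace_sym_mats A mat_sym_mats)
    moreover have "K (r *\<^sub>R mat 1 - A) = r *\<^sub>R mat 1 - K A"
      by (simp add: linear_diff[OF K] linear_cmul[OF K] K1)
    ultimately show ?thesis
      using Kbound r A psd_iff_qbound[of A r] psd_iff_qbound[of "K A" r] by metis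
  qed
  then obtain R where R: "orthogonal_matrix R" "\<And>A. A \<in> sym_mats \<Longrightarrow> K A = R ** A ** transpose R"
    using order_iso_is_congruence[OF K Ksym _ K1] by blast
  have "L A = c *\<^sub>R K A" for A by (simp add: K_def cc)
  then show ?thesis using that[OF R(1) c(1)] R(2) by simp
qed

section \<open>From onto preservers to isometries\<close>

text \<open>\<open>L\<close> is constrained on symmetric matrices only. \<open>G\<close> applies it
  to the symmetric part and keeps the skew part, which gives a linear map on the whole
  space.\<close>

lemma linear_extension_from_sym_mats:
  fixes L :: "real^'n^'n \<Rightarrow> real^'n^'n"
  assumes L: "linear_on_sym_mats L"
  obtains G where "linear G" "\<And>A. A \<in> sym_mats \<Longrightarrow> G A = L A"
    "\<And>A. G A = L ((1/2) *\<^sub>R (A + transpose A)) + (1/2) *\<^sub>R (A - transpose A)"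
proof -
  define h where "h A = (1/2) *\<^sub>R (A + transpose A)" for A :: "real^'n^'n"
  define G where "G A = L (h A) + (1/2) *\<^sub>R (A - transpose A)" for A
  have h: "h A \<in> sym_mats" "h (A + B) = h A + h B" "h (r *\<^sub>R A) = r *\<^sub>R h A" for A B r
    by (simp_all add: h_def sym_mats_def transpose_def vec_eq_iff algebra_simps)
  have "linear G"
  proof (rule linearI)
    show "G (A + B) = G A + G B" for A B
    proof -
      have "L (h (A + B)) = L (h A) + L (h B)"
        using L h by (simp add: linear_on_sym_mats_def)
      then show ?thesis by (simp add: G_def transpose_def vec_eq_iff algebra_simps add_divide_distrib)
    qed
    show "G (r *\<^sub>R A) = r *\<^sub>R G A" for r A
    proof -
      have "L (h (r *\<^sub>R A)) = r *\<^sub>R L (h A)"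
        using L h by (simp add: linear_on_sym_mats_def)
      then show ?thesis by (simp add: G_def transpose_def vec_eq_iff algebra_simps)
    qed
  qed
  moreover have "G A = L A" if "A \<in> sym_mats" for A
  proof -
    have "transpose A = A" using that by (simp add: sym_mats_def)
    then show ?thesis by (simp add: G_def h_def flip: scaleR_2)
  qed
  ultimately show ?thesis using that G_def unfolding h_def by blast
qed

lemma schur_stable_small_multiple:
  assumes A: "A \<in> sym_mats"
  obtains s where "s > 0" "schur_stable ((1/s) *\<^sub>R A)"
proof -
  obtain r where r: "0 \<le> r" "qbound A r" using abs_qform_attains_max[of A] by blast
  then show ?thesis using that[of "r + 1"] qbound_iff_schur_stable[OF A r(1)] by simp
qed

text \<open>Every symmetric matrix has a stable multiple, so surjectivity spreads from the stable
  set to all of \<open>sym_mats\<close>. Finite dimension then gives injectivity, and with it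
  stability of \<open>L A\<close> implies that of \<open>A\<close>.\<close>

lemma onto_preserver_imp_isometry:
  fixes L :: "real^'n^'n \<Rightarrow> real^'n^'n"
  assumes L: "linear_on_sym_mats L" and P: "onto_preserver_schur_stability L"
  shows "\<And>B. B \<in> sym_mats \<Longrightarrow> \<exists>A\<in>sym_mats. L A = B"
    and "\<And>A r. A \<in> sym_mats \<Longrightarrow> 0 \<le> r \<Longrightarrow> qbound (L A) r \<longleftrightarrow> qbound A r"
proof -
  have im: "L ` {A \<in> sym_mats. schur_stable A} = {A \<in> sym_mats. schur_stable A}"
    using P by (simp add: onto_preserver_schur_stability_def)
  have sym: "L A \<in> sym_mats" if "A \<in> sym_mats" for A using L that by (simp add: linear_on_sym_mats_def)
  have scale: "L (r *\<^sub>R A) = r *\<^sub>R L A" if "A \<in> sym_mats" for A r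
    using L that by (simp add: linear_on_sym_mats_def)
  note mul = subspace_mul[OF subspace_sym_mats]
  show onto: "\<exists>A\<in>sym_mats. L A = B" if B: "B \<in> sym_mats" for B
  proof -
    obtain s where s: "s > 0" "schur_stable ((1/s) *\<^sub>R B)" using schur_stable_small_multiple[OF B] .
    then have "(1/s) *\<^sub>R B \<in> L ` {A \<in> sym_mats. schur_stable A}" using B by (simp add: im mul)
    then obtain A where A: "A \<in> sym_mats" "L A = (1/s) *\<^sub>R B" by (metis (mono_tags, lifting) imageE mem_Collect_eq)
    then have "L (s *\<^sub>R A) = B" using s(1) by (simp add: scale)
    then show ?thesis using A(1) mul by blast
  qed
  obtain G where G: "linear G" "\<And>A. A \<in> sym_mats \<Longrightarrow> G A = L A"
    "\<And>A. G A = L ((1/2) *\<^sub>R (A + transpose A)) + (1/2) *\<^sub>R (A - transpose A)"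
    using linear_extension_from_sym_mats[OF L] by blast
  \<comment> \<open>Surjective linear maps on the full matrix space are injective, which is why
    \<open>G\<close> stands in for \<open>L\<close>. A preimage of \<open>B\<close> is a preimage of
    its symmetric part plus its skew part \<open>W\<close>.\<close>
  have "surj G"
    unfolding surj_def
  proof
    fix B :: "real^'n^'n"
    define S where "S = (1/2) *\<^sub>R (B + transpose B)"
    define W where "W = (1/2) *\<^sub>R (B - transpose B)"
    have "S \<in> sym_mats" by (simp add: S_def sym_mats_def transpose_def vec_eq_iff algebra_simps)
    then obtain A where A: "A \<in> sym_mats" "L A = S" using onto by blast
    have tA: "transpose A = A" using A(1) by (simp add: sym_mats_def)
    have "(1/2) *\<^sub>R ((A + W) + transpose (A + W)) = A" "(1/2) *\<^sub>R ((A + W) - transpose (A + W)) = W"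
      using tA by (simp_all add: W_def transpose_def vec_eq_iff field_simps)
    then have "G (A + W) = S + W" using G(3) A(2) by metis
    also have "\<dots> = B" by (simp add: S_def W_def vec_eq_iff field_simps)
    finally show "\<exists>x. B = G x" by metis
  qed
  then have "inj G" using G(1) linear_surjective_imp_injective by blast
  then have inj: "A = B" if "A \<in> sym_mats" "B \<in> sym_mats" "L A = L B" for A B
    using that G(2) by (metis injD)
  have schur: "schur_stable (L A) \<longleftrightarrow> schur_stable A" if A: "A \<in> sym_mats" for A
  proof
    assume "schur_stable A" then show "schur_stable (L A)" using im A by blast
  next
    assume "schur_stable (L A)"
    \<comment> \<open>The image contains \<open>L A\<close> as the value at some stable matrix;
      injectivity identifies that matrix with \<open>A\<close>.\<close>
    then have "L A \<in> L ` {A \<in> sym_mats. schur_stable A}" using im A sym by blast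
    then show "schur_stable A" using inj[OF A] by auto
  qed
  show "qbound (L A) r \<longleftrightarrow> qbound A r" if A: "A \<in> sym_mats" and r: "0 \<le> r" for A r
  proof -
    have "schur_stable ((1/s) *\<^sub>R L A) \<longleftrightarrow> schur_stable ((1/s) *\<^sub>R A)" for s
      using schur[OF mul[OF A]] scale[OF A] by metis
    then show ?thesis using qbound_iff_schur_stable[OF A r] qbound_iff_schur_stable[OF sym[OF A] r] by simp
  qed
qed

section \<open>Signed congruences as preservers, and the characterization\<close>

text \<open>The form of the new matrix at \<open>x\<close> is \<open>c\<close> times the form of
  \<open>A\<close> at \<open>transpose R *v x\<close>, a vector of the same length as
  \<open>x\<close>.\<close>

lemma schur_stable_signed_congruence:
  fixes R :: "real^'n^'n"
  assumes A: "A \<in> sym_mats" "schur_stable A" and R: "orthogonal_matrix R" and c: "c \<in> {1, -1::real}"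
  shows "c *\<^sub>R (R ** A ** transpose R) \<in> {A \<in> sym_mats. schur_stable A}"
proof -
  let ?B = "c *\<^sub>R (R ** A ** transpose R)"
  have RAR: "R ** A ** transpose R \<in> sym_mats"
    using congruence_sym_mats[OF A(1), of "transpose R"] by simp
  have B: "?B \<in> sym_mats" by (intro subspace_mul subspace_sym_mats RAR)
  have "\<bar>qform ?B x\<bar> < x \<bullet> x" if "x \<noteq> 0" for x
  proof -
    let ?y = "transpose R *v x"
    have "R ** transpose R = mat 1" using R by (simp add: orthogonal_matrix_def)
    then have RR: "R *v ?y = x" by (simp only: matrix_vector_mul_assoc matrix_vector_mul_lid)
    have "?y \<noteq> 0" using RR that by (metis matrix_vector_mult_0_right)
    then have "\<bar>qform A ?y\<bar> < ?y \<bullet> ?y" using A(2) schur_stable_sym_iff[OF A(1)] by blast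
    also have "?y \<bullet> ?y = x \<bullet> x"
      using qform_congruence[of "transpose R" "mat 1" x] R by (simp add: orthogonal_matrix_def)
    finally have "\<bar>qform A ?y\<bar> < x \<bullet> x" .
    moreover have "qform ?B x = c * qform A ?y"
      using qform_congruence[of "transpose R" A x] by (simp add: qform_scaleR)
    ultimately show ?thesis using c by auto
  qed
  then show ?thesis using B schur_stable_sym_iff[OF B] by blast
qed

theorem corollary2p17:
  fixes L :: "real^'n^'n \<Rightarrow> real^'n^'n"
  assumes "linear_on_sym_mats L"
  shows "onto_preserver_schur_stability L \<longleftrightarrow>
    (\<exists>R :: real^'n^'n. \<exists>c :: real. orthogonal_matrix R \<and> c \<in> {1, -1} \<and>
       (\<forall>A\<in>sym_mats. L A = c *\<^sub>R (R ** A ** transpose R)))"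
proof
  assume P: "onto_preserver_schur_stability L"
  obtain G where G: "linear G" "\<And>A. A \<in> sym_mats \<Longrightarrow> G A = L A"
    using linear_extension_from_sym_mats[OF assms] by metis
  have "G A \<in> sym_mats" if "A \<in> sym_mats" for A
    using assms that G(2) by (simp add: linear_on_sym_mats_def)
  moreover have "qbound (G A) r \<longleftrightarrow> qbound A r" if "A \<in> sym_mats" "0 \<le> r" for A r
    using onto_preserver_imp_isometry(2)[OF assms P that] G(2)[OF that(1)] by simp
  moreover have "\<exists>A\<in>sym_mats. G A = B" if "B \<in> sym_mats" for B
    using onto_preserver_imp_isometry(1)[OF assms P that] G(2) by auto
  ultimately obtain R c where "orthogonal_matrix R" "c \<in> {1, -1}"
    "\<And>A. A \<in> sym_mats \<Longrightarrow> G A = c *\<^sub>R (R ** A ** transpose R)"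
    using isometry_is_signed_congruence[OF G(1)] by blast
  then show "\<exists>R c. orthogonal_matrix R \<and> c \<in> {1, -1} \<and>
      (\<forall>A\<in>sym_mats. L A = c *\<^sub>R (R ** A ** transpose R))"
    using G(2) by metis
next
  assume "\<exists>R c. orthogonal_matrix R \<and> c \<in> {1, -1} \<and>
      (\<forall>A\<in>sym_mats. L A = c *\<^sub>R (R ** A ** transpose R))"
  then obtain R c where R: "orthogonal_matrix R" and c: "c \<in> {1, -1}"
    and L: "\<And>A. A \<in> sym_mats \<Longrightarrow> L A = c *\<^sub>R (R ** A ** transpose R)" by blast
  let ?S = "{A \<in> sym_mats. schur_stable A} :: (real^'n^'n) set"
  show "onto_preserver_schur_stability L"
    unfolding onto_preserver_schur_stability_def
  proof
    show "L ` ?S \<subseteq> ?S" using schur_stable_signed_congruence[OF _ _ R c] L by force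
    show "?S \<subseteq> L ` ?S"
    proof
      fix B assume B: "B \<in> ?S"
      \<comment> \<open>The inverse map is again a signed congruence, with
        \<open>transpose R\<close> and the same sign, so it preserves stability too.\<close>
      let ?A = "c *\<^sub>R (transpose R ** B ** R)"
      have A: "?A \<in> ?S"
        using schur_stable_signed_congruence[of B "transpose R" c] B R c by simp
      have "L ?A = (c * c) *\<^sub>R ((R ** transpose R) ** B ** (R ** transpose R))"
        using A L by (simp add: matrix_scalar_ac flip: scalar_matrix_assoc matrix_mul_assoc)
      also have "\<dots> = B" using R c by (auto simp: orthogonal_matrix_def)
      finally show "B \<in> L ` ?S" using A by (metis imageI)
    qed
  qed
qed

end
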